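(* Let $d\ge 2$, let $\mathcal{A}\in\mathbb{R}^{n_1\times\cdots\times n_d}$, and let $\mathcal{A}=\sum_{i=1}^{N}\tilde\sigma_i\mathcal{T}_i$ be a TTr1 decomposition of $\mathcal{A}$ (as produced by the TTr1SVD procedure described in the context), with terms relabeled so that $\tilde\sigma_1\ge\tilde\sigma_2\ge\cdots\ge\tilde\sigma_N$. Let $\tilde{\mathcal{A}}=\sum_{i=1}^{R}\tilde\sigma_i\mathcal{T}_i$ be the sum of the first $R$ terms. Then $$\|\mathcal{A}-\tilde{\mathcal{A}}\|_F=\sqrt{\tilde\sigma_{R+1}^2+\cdots+\tilde\sigma_N^2}.$$
   Context: The inner product of tensors is $\langle\mathcal{A},\mathcal{B}\rangle=\sum_{i_1,\dots,i_d}\mathcal{A}_{i_1\cdots i_d}\mathcal{B}_{i_1\cdots i_d}$, and the Frobenius norm is $\|\mathcal{A}\|_F=\langle\mathcal{A},\mathcal{A}\rangle^{1/2}$. The outer product $a^{(1)}\circ\cdots\circ a^{(d)}$ of vectors is the tensor with entries $a^{(1)}_{i_1}\cdots a^{(d)}_{i_d}$. TTr1SVD procedure. Let $r_k=\min\left(n_{k+1},\prod_{i=k+2}^{d}n_i\right)$ for $0\le k\le d-2$, and $N=\prod_{k=0}^{d-2}r_k$. Level 0: reshape $\mathcal{A}$ into the $n_1\times\prod_{i=2}^d n_i$ matrix $\bar{\mathcal{A}}$ with rows indexed by $i_1$ and columns by $(i_2,\dots,i_d)$. Take an economical SVD $\bar{\mathcal{A}}=\sum_{j=1}^{r_0}\sigma_j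 u_j v_j^T$, with $\sigma_j\ge0$, $u_1,\dots,u_{r_0}$ orthonormal and $v_1,\dots,v_{r_0}$ orthonormal (zero singular values are allowed and kept). Level $k$, for $1\le k\le d-2$: for each node $(j_1,\dots,j_k)$ with $1\le j_{s+1}\le r_s$, the unit vector $v_{j_1\cdots j_k}$ is indexed by $(i_{k+1},\dots,i_d)$. Reshape it into the $n_{k+1}\times\prod_{i=k+2}^d n_i$ matrix $\bar v_{j_1\cdots j_k}$ with rows indexed by $i_{k+1}$. Take an economical SVD $\bar v_{j_1\cdots j_k}=\sum_{j=1}^{r_k}\sigma_{j_1\cdots j_k j}\,u_{j_1\cdots j_k j}\,v_{j_1\cdots j_k j}^T$, again with $\sigma$'s nonnegative and the $u$'s and the $v$'s each orthonormal. The leaves of the resulting tree are the $N$ tuples $(j_1,\dots,j_{d-1})$ with $1\le j_{s+1}\le r_s$ for $0\le s\le d-2$. To each leaf are attached the weight $\tilde\sigma_{j_1\cdots j_{d-1}}=\sigma_{j_1}\sigma_{j_1j_2}\cdots\sigma_{j_1\cdots j_{d-1}}$ and the rank-1 tensor $\mathcal{T}_{j_1\cdots j_{d-1}}=u_{j_1}\circ u_{j_1j_2}\circ\cdots\circ u_{j_1\cdots j_{d-1}}\circ v_{j_1\cdots j_{d-1}}$. The TTr1 decomposition is $\mathcal{A}=\sum\tilde\sigma_{j_1\cdots j_{d-1}}\mathcal{T}_{j_1\cdots j_{d-1}}$, the sum being over all leaves; $(\tilde\sigma_i,\mathcal{T}_i)_{i=1}^N$ denotes an enumeration of the pairs attached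 to the leaves. *)

theory Defs
  imports Complex_Main
begin

text \<open>
  A tensor of dimensions \<open>ns = [n\<^sub>1, \<dots>, n\<^sub>d]\<close> is a function on multi-indices
  \<open>[i\<^sub>1, \<dots>, i\<^sub>d]\<close>; only its values on \<open>multi_indices ns\<close> (indices counted from 1) matter.
  List positions count from 0, so \<open>ns ! k\<close> is \<open>n\<^sub>k\<^sub>+\<^sub>1\<close>.
\<close>

type_synonym tensor = "nat list \<Rightarrow> real"

definition multi_indices :: "nat list \<Rightarrow> nat list set" where
  "multi_indices ns = listset (map (\<lambda>n. {1..n}) ns)"

definition tensor_inner :: "nat list \<Rightarrow> tensor \<Rightarrow> tensor \<Rightarrow> real" where
  "tensor_inner ns A B = (\<Sum>is\<in>multi_indices ns. A is * B is)"

definition frobenius_norm :: "nat list \<Rightarrow> tensor \<Rightarrow> real" where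
  "frobenius_norm ns A = sqrt (tensor_inner ns A A)"

definition outer_product :: "(nat \<Rightarrow> real) list \<Rightarrow> tensor" where
  "outer_product as is = (\<Prod>k<length as. (as ! k) (is ! k))"

text \<open>Matrices have rows indexed by \<open>i\<close> and columns indexed by the remaining multi-index,
  so that no linear ordering of the columns has to be chosen.\<close>

definition reshape :: "tensor \<Rightarrow> nat \<Rightarrow> nat list \<Rightarrow> real" where
  "reshape A i is = A (i # is)"

definition orthonormal_family :: "'i set \<Rightarrow> nat \<Rightarrow> (nat \<Rightarrow> 'i \<Rightarrow> real) \<Rightarrow> bool" where
  "orthonormal_family I r w \<longleftrightarrow>
     (\<forall>j\<in>{1..r}. \<forall>j'\<in>{1..r}. (\<Sum>i\<in>I. w j i * w j' i) = (if j = j' then 1 else 0))"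

text \<open>The triplets \<open>(\<sigma> j, u j, v j)\<close>, \<open>j = 1, \<dots>, r\<close>, form a singular value decomposition
  of the matrix \<open>M\<close> with rows \<open>I\<close> and columns \<open>J\<close>. It is the economical one for
  \<open>r = min (card I) (card J)\<close>. Singular values may be zero and need not be sorted.\<close>

definition is_svd ::
  "'i set \<Rightarrow> 'j set \<Rightarrow> nat \<Rightarrow> ('i \<Rightarrow> 'j \<Rightarrow> real)
     \<Rightarrow> (nat \<Rightarrow> real) \<Rightarrow> (nat \<Rightarrow> 'i \<Rightarrow> real) \<Rightarrow> (nat \<Rightarrow> 'j \<Rightarrow> real) \<Rightarrow> bool" where
  "is_svd I J r M \<sigma> u v \<longleftrightarrow>
     (\<forall>a\<in>I. \<forall>b\<in>J. M a b = (\<Sum>j=1..r. \<sigma> j * u j a * v j b)) \<and>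
     (\<forall>j\<in>{1..r}. \<sigma> j \<ge> 0) \<and>
     orthonormal_family I r u \<and>
     orthonormal_family J r v"

definition ttr1_rank :: "nat list \<Rightarrow> nat \<Rightarrow> nat" where
  "ttr1_rank ns k = min (ns ! k) (prod_list (drop (k + 1) ns))"

definition ttr1_nodes :: "nat list \<Rightarrow> nat \<Rightarrow> nat list set" where
  "ttr1_nodes ns k = listset (map (\<lambda>s. {1..ttr1_rank ns s}) [0..<k])"

definition ttr1_leaves :: "nat list \<Rightarrow> nat list set" where
  "ttr1_leaves ns = ttr1_nodes ns (length ns - 1)"

definition ttr1_size :: "nat list \<Rightarrow> nat" where
  "ttr1_size ns = (\<Prod>k=0..length ns - 2. ttr1_rank ns k)"

text \<open>\<open>\<sigma>\<close>, \<open>u\<close>, \<open>v\<close> label the nodes \<open>[j\<^sub>1, \<dots>, j\<^sub>k]\<close>, \<open>k \<ge> 1\<close>, of the tree by a possible outcome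
  of the procedure, whose singular value decompositions are not unique. The vector at a node of
  level \<open>k\<close> is stored as a tensor \<open>v p\<close> of dimensions \<open>drop k ns\<close>.\<close>

definition is_TTr1SVD ::
  "nat list \<Rightarrow> tensor \<Rightarrow> (nat list \<Rightarrow> real) \<Rightarrow> (nat list \<Rightarrow> nat \<Rightarrow> real)
     \<Rightarrow> (nat list \<Rightarrow> tensor) \<Rightarrow> bool" where
  "is_TTr1SVD ns A \<sigma> u v \<longleftrightarrow>
     is_svd {1..ns ! 0} (multi_indices (drop 1 ns)) (ttr1_rank ns 0) (reshape A)
       (\<lambda>j. \<sigma> [j]) (\<lambda>j. u [j]) (\<lambda>j. v [j]) \<and>
     (\<forall>k\<in>{1..length ns - 2}. \<forall>p\<in>ttr1_nodes ns k.
       is_svd {1..ns ! k} (multi_indices (drop (k + 1) ns)) (ttr1_rank ns k) (reshape (v p))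
         (\<lambda>j. \<sigma> (p @ [j])) (\<lambda>j. u (p @ [j])) (\<lambda>j. v (p @ [j])))"

definition ttr1_weight :: "(nat list \<Rightarrow> real) \<Rightarrow> nat list \<Rightarrow> real" where
  "ttr1_weight \<sigma> p = (\<Prod>k=1..length p. \<sigma> (take k p))"

text \<open>At a leaf, \<open>v p\<close> has order one and is read as the vector \<open>i \<mapsto> v p [i]\<close>.\<close>

definition ttr1_term ::
  "(nat list \<Rightarrow> nat \<Rightarrow> real) \<Rightarrow> (nat list \<Rightarrow> tensor) \<Rightarrow> nat list \<Rightarrow> tensor" where
  "ttr1_term u v p =
     outer_product (map (\<lambda>k. u (take k p)) [1..<length p + 1] @ [\<lambda>i. v p [i]])"

end

theory Submission
  imports Defs
begin

text \<open>
  The rank-1 tensors at the leaves are orthonormal for the tensor inner product, and the whole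
  sum over the leaves is \<open>A\<close>. So \<open>A\<close> minus a partial sum is the sum of the remaining terms, and
  the identity is Pythagoras' theorem (\<open>frobenius_norm_orthonormal_sum\<close>).

  Both facts about the leaves follow by recursion down the tree. The subtree below a child
  \<open>[j]\<close> of the root is the tree of the lower-order tensor \<open>v [j]\<close>, and each of its rank-1 terms,
  multiplied on the left by \<open>u [j]\<close>, is a term of the whole tree
  (\<open>ttr1_term_Cons\<close>). Substituting the expansions of the \<open>v [j]\<close> into the singular value
  decomposition at the root gives the expansion of \<open>A\<close> (\<open>ttr1_tree_expansion\<close>). The inner
  product of two outer products is the product of the inner products of the factors
  (\<open>tensor_inner_Cons\<close>): two leaves that lie below different children of the root are orthogonal
  because of their first factors \<open>u [j]\<close>, and for two leaves below the same child the first
  factor has norm one and the question moves to the subtree (\<open>ttr1_tree_orthonormal\<close>).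

  Storing the decomposed tensor itself as \<open>v []\<close> makes the root a node like all others. The
  recursion then ends at tensors of order one, whose tree is a single leaf \<open>[]\<close>.
\<close>

section \<open>Multi-indices\<close>

lemma sum_set_Cons:
  "sum f (set_Cons A B) = (\<Sum>a\<in>A. \<Sum>b\<in>B. f (a # b))"
proof -
  have "set_Cons A B = (\<lambda>(a, b). a # b) ` (A \<times> B)"
    by (auto simp: set_Cons_def)
  moreover have "inj_on (\<lambda>(a, b). a # b) (A \<times> B)"
    by (auto simp: inj_on_def)
  ultimately show ?thesis
    by (simp add: sum.reindex sum.cartesian_product case_prod_unfold)
qed

lemma multi_indices_Nil [simp]: "multi_indices [] = {[]}"
  by (simp add: multi_indices_def)

lemma multi_indices_Cons: "multi_indices (n # ms) = set_Cons {1..n} (multi_indices ms)"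
  by (simp add: multi_indices_def)

lemma tensor_inner_cong:
  assumes "\<And>is. is \<in> multi_indices ns \<Longrightarrow> A is = A' is"
    and "\<And>is. is \<in> multi_indices ns \<Longrightarrow> B is = B' is"
  shows "tensor_inner ns A B = tensor_inner ns A' B'"
  using assms by (simp add: tensor_inner_def)

text \<open>The double sum over the first index and over the other indices splits into a product.
  This peels off the first factor of an outer product.\<close>

lemma tensor_inner_Cons:
  assumes "\<And>i is. i \<in> {1..n} \<Longrightarrow> is \<in> multi_indices ms \<Longrightarrow> A (i # is) = a i * A' is"
    and "\<And>i is. i \<in> {1..n} \<Longrightarrow> is \<in> multi_indices ms \<Longrightarrow> B (i # is) = b i * B' is"
  shows "tensor_inner (n # ms) A B = (\<Sum>i=1..n. a i * b i) * tensor_inner ms A' B'"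
proof -
  have "tensor_inner (n # ms) A B = (\<Sum>i=1..n. \<Sum>is\<in>multi_indices ms. A (i # is) * B (i # is))"
    by (simp add: tensor_inner_def multi_indices_Cons sum_set_Cons)
  also have "\<dots> = (\<Sum>i=1..n. \<Sum>is\<in>multi_indices ms. (a i * b i) * (A' is * B' is))"
    using assms by (intro sum.cong refl) (simp add: algebra_simps)
  also have "\<dots> = (\<Sum>i=1..n. a i * b i) * tensor_inner ms A' B'"
    by (simp add: tensor_inner_def sum_product)
  finally show ?thesis .
qed

section \<open>Pythagoras for orthonormal tensors\<close>

lemma tensor_inner_sum_sum:
  "tensor_inner ns (\<lambda>is. \<Sum>i\<in>I. c i * S i is) (\<lambda>is. \<Sum>j\<in>J. d j * T j is) =
     (\<Sum>i\<in>I. \<Sum>j\<in>J. c i * d j * tensor_inner ns (S i) (T j))"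
proof -
  have "tensor_inner ns (\<lambda>is. \<Sum>i\<in>I. c i * S i is) (\<lambda>is. \<Sum>j\<in>J. d j * T j is) =
      (\<Sum>is\<in>multi_indices ns. \<Sum>i\<in>I. \<Sum>j\<in>J. c i * d j * (S i is * T j is))"
    by (simp add: tensor_inner_def sum_product mult_ac)
  also have "\<dots> = (\<Sum>i\<in>I. \<Sum>is\<in>multi_indices ns. \<Sum>j\<in>J. c i * d j * (S i is * T j is))"
    by (rule sum.swap)
  also have "\<dots> = (\<Sum>i\<in>I. \<Sum>j\<in>J. \<Sum>is\<in>multi_indices ns. c i * d j * (S i is * T j is))"
    by (intro sum.cong refl sum.swap)
  finally show ?thesis
    by (simp add: tensor_inner_def sum_distrib_left)
qed

lemma frobenius_norm_orthonormal_sum: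
  assumes "finite I"
    and "\<And>i j. i \<in> I \<Longrightarrow> j \<in> I \<Longrightarrow> tensor_inner ns (T i) (T j) = (if i = j then 1 else 0)"
  shows "frobenius_norm ns (\<lambda>is. \<Sum>i\<in>I. c i * T i is) = sqrt (\<Sum>i\<in>I. (c i)\<^sup>2)"
proof -
  have "(\<Sum>i\<in>I. \<Sum>j\<in>I. c i * c j * tensor_inner ns (T i) (T j)) =
      (\<Sum>i\<in>I. \<Sum>j\<in>I. if i = j then c i * c j else 0)"
    using assms(2) by (intro sum.cong refl) simp
  also have "\<dots> = (\<Sum>i\<in>I. (c i)\<^sup>2)"
    using assms(1) by (simp add: power2_eq_square)
  finally show ?thesis
    by (simp add: frobenius_norm_def tensor_inner_sum_sum)
qed

section \<open>The tree of decompositions\<close>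

text \<open>The condition \<open>is_TTr1SVD\<close> with the root included among the nodes: the decomposed tensor
  is \<open>v []\<close>. Unlike \<open>is_TTr1SVD\<close>, it is inherited by the subtrees, down to order one, where it
  is trivial.\<close>

definition ttr1_tree ::
  "nat list \<Rightarrow> (nat list \<Rightarrow> real) \<Rightarrow> (nat list \<Rightarrow> nat \<Rightarrow> real) \<Rightarrow> (nat list \<Rightarrow> tensor) \<Rightarrow> bool" where
  "ttr1_tree ns \<sigma> u v \<longleftrightarrow>
     (\<forall>k<length ns - 1. \<forall>p\<in>ttr1_nodes ns k.
       is_svd {1..ns ! k} (multi_indices (drop (k + 1) ns)) (ttr1_rank ns k) (reshape (v p))
         (\<lambda>j. \<sigma> (p @ [j])) (\<lambda>j. u (p @ [j])) (\<lambda>j. v (p @ [j])))"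

lemma ttr1_nodes_0 [simp]: "ttr1_nodes ns 0 = {[]}"
  by (simp add: ttr1_nodes_def)

lemma ttr1_rank_Cons_Suc [simp]: "ttr1_rank (n # ms) (Suc k) = ttr1_rank ms k"
  by (simp add: ttr1_rank_def)

lemma ttr1_nodes_Cons_Suc:
  "ttr1_nodes (n # ms) (Suc k) = set_Cons {1..ttr1_rank (n # ms) 0} (ttr1_nodes ms k)"
  unfolding ttr1_nodes_def
  by (simp only: upt_conv_Cons[OF zero_less_Suc] map_Suc_upt[symmetric] list.map listset.simps
      list.map_comp comp_def ttr1_rank_Cons_Suc)

lemma ttr1_leaves_singleton [simp]: "ttr1_leaves [n] = {[]}"
  by (simp add: ttr1_leaves_def)

lemma ttr1_leaves_Cons:
  "ms \<noteq> [] \<Longrightarrow>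
     ttr1_leaves (n # ms) = set_Cons {1..ttr1_rank (n # ms) 0} (ttr1_leaves ms)"
  by (cases ms) (simp_all add: ttr1_leaves_def ttr1_nodes_Cons_Suc)

lemma ttr1_tree_if_is_TTr1SVD:
  assumes "is_TTr1SVD ns A \<sigma> u v"
  shows "ttr1_tree ns \<sigma> u (v([] := A))"
  unfolding ttr1_tree_def
proof (intro allI impI ballI)
  fix k p assume k: "k < length ns - 1" and p: "p \<in> ttr1_nodes ns k"
  show "is_svd {1..ns ! k} (multi_indices (drop (k + 1) ns)) (ttr1_rank ns k)
      (reshape ((v([] := A)) p))
      (\<lambda>j. \<sigma> (p @ [j])) (\<lambda>j. u (p @ [j])) (\<lambda>j. (v([] := A)) (p @ [j]))"
  proof (cases k)
    case 0
    then show ?thesis using assms p by (simp add: is_TTr1SVD_def)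
  next
    case (Suc k')
    \<comment> \<open>Below the root, nodes are nonempty lists, so storing \<open>A\<close> at \<open>[]\<close> does not affect them.\<close>
    then have "p \<noteq> []"
      using p by (cases ns) (auto simp: ttr1_nodes_def set_Cons_def upt_conv_Cons simp del: upt_Suc)
    moreover have "k \<in> {1..length ns - 2}"
      using k Suc by auto
    ultimately show ?thesis
      using assms p by (simp add: is_TTr1SVD_def)
  qed
qed

lemma ttr1_tree_root:
  assumes "ttr1_tree (n # ms) \<sigma> u v" and "ms \<noteq> []"
  shows "is_svd {1..n} (multi_indices ms) (ttr1_rank (n # ms) 0) (reshape (v []))
           (\<lambda>j. \<sigma> [j]) (\<lambda>j. u [j]) (\<lambda>j. v [j])"
  using assms by (auto simp: ttr1_tree_def dest: spec[where x = 0])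

lemma ttr1_tree_child:
  assumes "ttr1_tree (n # ms) \<sigma> u v" and "j \<in> {1..ttr1_rank (n # ms) 0}"
  shows "ttr1_tree ms (\<lambda>p. \<sigma> (j # p)) (\<lambda>p. u (j # p)) (\<lambda>p. v (j # p))"
  unfolding ttr1_tree_def
proof (intro allI impI ballI)
  fix k p assume "k < length ms - 1" and "p \<in> ttr1_nodes ms k"
  then have "Suc k < length (n # ms) - 1" and "j # p \<in> ttr1_nodes (n # ms) (Suc k)"
    using assms(2) by (auto simp: ttr1_nodes_Cons_Suc set_Cons_def)
  with assms(1) show "is_svd {1..ms ! k} (multi_indices (drop (k + 1) ms)) (ttr1_rank ms k)
      (reshape (v (j # p)))
      (\<lambda>i. \<sigma> (j # p @ [i])) (\<lambda>i. u (j # p @ [i])) (\<lambda>i. v (j # p @ [i]))"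
    unfolding ttr1_tree_def by fastforce
qed

section \<open>Weights and terms along a path\<close>

lemma ttr1_weight_Nil [simp]: "ttr1_weight \<sigma> [] = 1"
  by (simp add: ttr1_weight_def)

lemma ttr1_weight_Cons: "ttr1_weight \<sigma> (j # p) = \<sigma> [j] * ttr1_weight (\<lambda>p. \<sigma> (j # p)) p"
proof -
  have "ttr1_weight \<sigma> (j # p) = (\<Prod>k=Suc 0..Suc (length p). \<sigma> (take k (j # p)))"
    by (simp add: ttr1_weight_def)
  also have "\<dots> = \<sigma> [j] * (\<Prod>k=Suc (Suc 0)..Suc (length p). \<sigma> (take k (j # p)))"
    by (subst prod.atLeast_Suc_atMost) simp_all
  also have "\<dots> = \<sigma> [j] * ttr1_weight (\<lambda>p. \<sigma> (j # p)) p"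
    unfolding prod.atLeast_Suc_atMost_Suc_shift by (simp add: ttr1_weight_def)
  finally show ?thesis .
qed

lemma outer_product_Cons: "outer_product (a # as) (i # is) = a i * outer_product as is"
  by (simp add: outer_product_def prod.lessThan_Suc_shift del: prod.lessThan_Suc)

text \<open>The second factor is the term of the path \<open>p\<close> in the subtree below \<open>[j]\<close>. This includes
  \<open>p = []\<close>, where \<open>[j]\<close> is itself a leaf and the second factor is the vector \<open>v [j]\<close>.\<close>

lemma ttr1_term_Cons:
  "ttr1_term u v (j # p) (i # is) =
     u [j] i * ttr1_term (\<lambda>p. u (j # p)) (\<lambda>p. v (j # p)) p is"
proof -
  have "map (\<lambda>k. u (take k (j # p))) [1..<length (j # p) + 1] =
      u [j] # map (\<lambda>k. u (j # take k p)) [1..<length p + 1]"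
    by (simp add: upt_conv_Cons map_Suc_upt[symmetric] comp_def del: upt_Suc)
  then show ?thesis
    by (simp add: ttr1_term_def outer_product_Cons del: upt_Suc)
qed

lemma ttr1_term_root:
  assumes "is \<in> multi_indices [n]"
  shows "ttr1_term u v [] is = v [] is"
  using assms by (auto simp: multi_indices_Cons set_Cons_def ttr1_term_def outer_product_def)

lemma ttr1_term_upd_root:
  "p \<noteq> [] \<Longrightarrow> ttr1_term u (v([] := A)) p = ttr1_term u v p"
  by (simp add: ttr1_term_def)

section \<open>Expansion and orthonormality\<close>

text \<open>The singular value decomposition at the root writes \<open>v []\<close> in terms of the \<open>v [j]\<close>, and
  the subtrees expand the \<open>v [j]\<close>.\<close>

lemma ttr1_tree_expansion:
  assumes "ns \<noteq> []" and "ttr1_tree ns \<sigma> u v" and "is \<in> multi_indices ns"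
  shows "v [] is = (\<Sum>p\<in>ttr1_leaves ns. ttr1_weight \<sigma> p * ttr1_term u v p is)"
  using assms
proof (induction ns arbitrary: \<sigma> u v "is" rule: list_nonempty_induct)
  case (single n)
  then show ?case by (simp add: ttr1_term_root)
next
  case (cons n ms)
  let ?r = "ttr1_rank (n # ms) 0"
  obtain i js where "is": "is = i # js" and i: "i \<in> {1..n}" and js: "js \<in> multi_indices ms"
    using cons.prems(2) by (auto simp: multi_indices_Cons set_Cons_def)
  have "v [] is = (\<Sum>j=1..?r. \<sigma> [j] * u [j] i * v [j] js)"
    using ttr1_tree_root[OF cons.prems(1) cons.hyps] i js by (simp add: "is" is_svd_def reshape_def)
  also have "\<dots> = (\<Sum>j=1..?r. \<sigma> [j] * u [j] i * (\<Sum>p\<in>ttr1_leaves ms.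
      ttr1_weight (\<lambda>p. \<sigma> (j # p)) p * ttr1_term (\<lambda>p. u (j # p)) (\<lambda>p. v (j # p)) p js))"
    using cons.IH[OF ttr1_tree_child[OF cons.prems(1)] js] by (intro sum.cong refl) simp
  also have "\<dots> = (\<Sum>j=1..?r. \<Sum>p\<in>ttr1_leaves ms.
      ttr1_weight \<sigma> (j # p) * ttr1_term u v (j # p) (i # js))"
    by (simp add: sum_distrib_left ttr1_weight_Cons ttr1_term_Cons mult_ac)
  also have "\<dots> = (\<Sum>p\<in>ttr1_leaves (n # ms). ttr1_weight \<sigma> p * ttr1_term u v p is)"
    by (simp add: ttr1_leaves_Cons[OF cons.hyps] sum_set_Cons "is")
  finally show ?case .
qed

text \<open>Two different leaves share a path up to the node where they separate. The factors before
  it have norm one, and at it they carry orthogonal vectors \<open>u\<close>. Two equal leaves have norm one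
  because each factor has; the last factor is a right singular vector of the parent node, which
  a tree of order one cannot see, so there the norm has to be assumed.\<close>

lemma ttr1_tree_orthonormal:
  assumes "ns \<noteq> []" and "ttr1_tree ns \<sigma> u v"
    and "length ns = 1 \<Longrightarrow> tensor_inner ns (v []) (v []) = 1"
    and "p \<in> ttr1_leaves ns" and "q \<in> ttr1_leaves ns"
  shows "tensor_inner ns (ttr1_term u v p) (ttr1_term u v q) = (if p = q then 1 else 0)"
  using assms
proof (induction ns arbitrary: \<sigma> u v p q rule: list_nonempty_induct)
  case (single n)
  then have "p = []" and "q = []"
    by simp_all
  moreover have "tensor_inner [n] (ttr1_term u v []) (ttr1_term u v []) =
      tensor_inner [n] (v []) (v [])"
    by (intro tensor_inner_cong ttr1_term_root)
  ultimately show ?case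
    using single.prems(2) by simp
next
  case (cons n ms)
  let ?r = "ttr1_rank (n # ms) 0"
  obtain j p' where p: "p = j # p'" "j \<in> {1..?r}" "p' \<in> ttr1_leaves ms"
    using cons.prems(3) by (auto simp: ttr1_leaves_Cons[OF cons.hyps] set_Cons_def)
  obtain l q' where q: "q = l # q'" "l \<in> {1..?r}" "q' \<in> ttr1_leaves ms"
    using cons.prems(4) by (auto simp: ttr1_leaves_Cons[OF cons.hyps] set_Cons_def)
  have svd: "is_svd {1..n} (multi_indices ms) ?r (reshape (v []))
      (\<lambda>j. \<sigma> [j]) (\<lambda>j. u [j]) (\<lambda>j. v [j])"
    by (rule ttr1_tree_root[OF cons.prems(1) cons.hyps])
  have first_factor: "(\<Sum>i=1..n. u [j] i * u [l] i) = (if j = l then 1 else 0)"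
    using svd p(2) q(2) by (simp add: is_svd_def orthonormal_family_def)
  have "tensor_inner ms (v [j]) (v [j]) = 1"
    using svd p(2) by (simp add: is_svd_def orthonormal_family_def tensor_inner_def)
  then have subtree: "tensor_inner ms
      (ttr1_term (\<lambda>p. u (j # p)) (\<lambda>p. v (j # p)) p')
      (ttr1_term (\<lambda>p. u (j # p)) (\<lambda>p. v (j # p)) q') = (if p' = q' then 1 else 0)"
    using p(3) q(3) by (intro cons.IH[OF ttr1_tree_child[OF cons.prems(1) p(2)]]) simp_all
  have "tensor_inner (n # ms) (ttr1_term u v p) (ttr1_term u v q) =
      (\<Sum>i=1..n. u [j] i * u [l] i) * tensor_inner ms
        (ttr1_term (\<lambda>p. u (j # p)) (\<lambda>p. v (j # p)) p')
        (ttr1_term (\<lambda>p. u (l # p)) (\<lambda>p. v (l # p)) q')"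
    by (intro tensor_inner_Cons) (simp_all add: p(1) q(1) ttr1_term_Cons)
  then show ?case
    using first_factor subtree by (cases "j = l") (simp_all add: p(1) q(1))
qed

section \<open>The error of a truncated decomposition\<close>

theorem lemma3p2:
  fixes ns :: "nat list" and A :: tensor
    and \<sigma> :: "nat list \<Rightarrow> real" and u :: "nat list \<Rightarrow> nat \<Rightarrow> real" and v :: "nat list \<Rightarrow> tensor"
    and leaf :: "nat \<Rightarrow> nat list" and w :: "nat \<Rightarrow> real" and T :: "nat \<Rightarrow> tensor"
    and N R :: nat
  assumes "length ns \<ge> 2"
    and "\<forall>n\<in>set ns. n \<ge> 1"
    and "is_TTr1SVD ns A \<sigma> u v"
    and "N = ttr1_size ns"
    and "bij_betw leaf {1..N} (ttr1_leaves ns)"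
    and "\<forall>i\<in>{1..N}. w i = ttr1_weight \<sigma> (leaf i)"
    and "\<forall>i\<in>{1..N}. T i = ttr1_term u v (leaf i)"
    and "\<forall>i\<in>{1..N}. \<forall>j\<in>{1..N}. i \<le> j \<longrightarrow> w i \<ge> w j"
    and "R \<le> N"
  shows "frobenius_norm ns (\<lambda>is. A is - (\<Sum>i=1..R. w i * T i is))
           = sqrt (\<Sum>i=R+1..N. (w i)\<^sup>2)"
proof -
  let ?v = "v([] := A)"
  have "ns \<noteq> []" and "length ns \<noteq> 1"
    using assms(1) by auto
  have tree: "ttr1_tree ns \<sigma> u ?v"
    by (rule ttr1_tree_if_is_TTr1SVD[OF assms(3)])
  have leaf: "leaf i \<in> ttr1_leaves ns" if "i \<in> {1..N}" for i
    using bij_betwE[OF assms(5)] that by blast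
  have leaves_nonempty: "p \<noteq> []" if "p \<in> ttr1_leaves ns" for p
  proof -
    obtain n m ms where "ns = n # m # ms"
      using assms(1) by (auto simp: numeral_2_eq_2 Suc_le_length_iff)
    then show ?thesis
      using that by (auto simp: ttr1_leaves_Cons set_Cons_def)
  qed
  have T: "T i = ttr1_term u ?v (leaf i)" if "i \<in> {1..N}" for i
    using assms(7) that leaf leaves_nonempty by (simp add: ttr1_term_upd_root)
  have orthonormal: "tensor_inner ns (T i) (T j) = (if i = j then 1 else 0)"
    if "i \<in> {1..N}" "j \<in> {1..N}" for i j
  proof -
    have "leaf i = leaf j \<longleftrightarrow> i = j"
      by (rule inj_on_eq_iff[OF bij_betw_imp_inj_on[OF assms(5)] that])
    moreover have "tensor_inner ns (ttr1_term u ?v (leaf i)) (ttr1_term u ?v (leaf j)) =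
        (if leaf i = leaf j then 1 else 0)"
      using \<open>length ns \<noteq> 1\<close>
      by (intro ttr1_tree_orthonormal[OF \<open>ns \<noteq> []\<close> tree] leaf that) simp
    ultimately show ?thesis
      by (simp only: T[OF that(1)] T[OF that(2)])
  qed
  have expansion: "A is = (\<Sum>i=1..N. w i * T i is)" if "is \<in> multi_indices ns" for "is"
  proof -
    have "A is = (\<Sum>p\<in>ttr1_leaves ns. ttr1_weight \<sigma> p * ttr1_term u ?v p is)"
      using ttr1_tree_expansion[OF \<open>ns \<noteq> []\<close> tree that] by simp
    also have "\<dots> = (\<Sum>i=1..N. ttr1_weight \<sigma> (leaf i) * ttr1_term u ?v (leaf i) is)"
      by (rule sum.reindex_bij_betw[OF assms(5), symmetric])
    also have "\<dots> = (\<Sum>i=1..N. w i * T i is)"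
      using assms(6) T by (intro sum.cong refl) simp
    finally show ?thesis .
  qed
  have remainder: "A is - (\<Sum>i=1..R. w i * T i is) = (\<Sum>i=R+1..N. w i * T i is)"
    if "is \<in> multi_indices ns" for "is"
  proof -
    have "(\<Sum>i=1..N. w i * T i is) = (\<Sum>i=1..R. w i * T i is) + (\<Sum>i=R+1..N. w i * T i is)"
      using sum.ub_add_nat[of 1 R "\<lambda>i. w i * T i is" "N - R"] assms(9) by simp
    then show ?thesis
      using expansion[OF that] by simp
  qed
  have "frobenius_norm ns (\<lambda>is. A is - (\<Sum>i=1..R. w i * T i is)) =
      frobenius_norm ns (\<lambda>is. \<Sum>i=R+1..N. w i * T i is)"
    unfolding frobenius_norm_def by (intro arg_cong[where f = sqrt] tensor_inner_cong remainder)
  also have "\<dots> = sqrt (\<Sum>i=R+1..N. (w i)\<^sup>2)"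
    by (intro frobenius_norm_orthonormal_sum orthonormal) auto
  finally show ?thesis .
qed

end
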